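(* Let $\gamma(s)$ be a pseudo null curve in $E_1^4$ with Frenet vector fields $F_1,\dots,F_4$ and let $r>0$ be constant. The tubular hypersurfaces $$T_1=\gamma\mp r\left(g\sin f\,F_2+\cos f\,F_3+\tfrac{\sin f}{2g}F_4\right),\quad T_2=\gamma\mp r\left(g\cos f\,F_2+\sin f\,F_3+\tfrac{\cos f}{2g}F_4\right),$$ $$T_3=\gamma\mp r\left(g\sinh f\,F_2+\cosh f\,F_3-\tfrac{\sinh f}{2g}F_4\right),\quad T_4=\gamma\mp r\left(g\cosh f\,F_2+\sinh f\,F_3-\tfrac{\cosh f}{2g}F_4\right)$$ are $(H_{T_i},K_{T_i})_{st}$-Weingarten, $(H_{T_i},K_{T_i})_{sw}$-Weingarten and $(H_{T_i},K_{T_i})_{tw}$-Weingarten for each $i\in\{1,2,3,4\}$, where $K_{T_i}$ and $H_{T_i}$ are the Gaussian and mean curvatures of $T_i$.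
   Context: $E_1^4$ is $\mathbb{R}^4$ with $\langle u,v\rangle=-u_1v_1+u_2v_2+u_3v_3+u_4v_4$. A pseudo null curve is a unit speed spacelike curve $\gamma(s)$ whose principal normal is null; it has a Frenet frame $F_1=\gamma',F_2,F_3,F_4$ with $\langle F_1,F_1\rangle=\langle F_3,F_3\rangle=\langle F_2,F_4\rangle=1$, all other products $\langle F_i,F_j\rangle$ zero, and $F_1'=k_1F_2$, $F_2'=k_2F_3$, $F_3'=k_3F_2-k_2F_4$, $F_4'=-k_1F_1-k_3F_3$, where $k_1=0$ if $\gamma$ is a straight line and $k_1=1$ otherwise. $f=f(t,w)$ and $g=g(t,w)$ are smooth real functions with $g$ nowhere zero; $\mp$ means either sign may be chosen. For a hypersurface $\Omega(u_1,u_2,u_3)$ in $E_1^4$ with unit normal $N$, $\varepsilon=\langle N,N\rangle=\pm1$, put $g_{ij}=\langle\Omega_{u_i},\Omega_{u_j}\rangle$, $h_{ij}=\langle\Omega_{u_iu_j},N\rangle$, $S=[g_{ij}]^{-1}[h_{ij}]$; then $K=\varepsilon\det[h_{ij}]/\det[g_{ij}]$ and $3\varepsilon H=\operatorname{tr}S$ (at points where $\det[g_{ij}]\ne0$). For parameters $x,y\in\{s,t,w\}$, a hypersurface with Gaussian curvature $K$ and mean curvature $H$ is $(H,K)_{xy}$-Weingarten if $H_xK_y-H_yK_x=0$, subscripts denoting partial derivatives. *)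

theory Defs
  imports "HOL-Analysis.Analysis"
begin

primrec Ck_on :: "nat \<Rightarrow> 'a::euclidean_space set \<Rightarrow> ('a \<Rightarrow> 'b::real_normed_vector) \<Rightarrow> bool" where
  "Ck_on 0 S f \<longleftrightarrow> continuous_on S f"
| "Ck_on (Suc k) S f \<longleftrightarrow> (\<forall>x\<in>S. f differentiable (at x)) \<and>
     (\<forall>v. Ck_on k S (\<lambda>x. frechet_derivative f (at x) v))"

(* Intended for open S only, since derivatives are taken with (at x). *)
definition smooth_on :: "'a::euclidean_space set \<Rightarrow> ('a \<Rightarrow> 'b::real_normed_vector) \<Rightarrow> bool" where
  "smooth_on S f \<longleftrightarrow> (\<forall>k. Ck_on k S f)"

definition minkowski :: "real^4 \<Rightarrow> real^4 \<Rightarrow> real" where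
  "minkowski u v = - (u$1 * v$1) + u$2 * v$2 + u$3 * v$3 + u$4 * v$4"

definition straight_line_on :: "real set \<Rightarrow> (real \<Rightarrow> real^4) \<Rightarrow> bool" where
  "straight_line_on I \<gamma> \<longleftrightarrow> (\<exists>p v. \<forall>s\<in>I. \<gamma> s = p + s *\<^sub>R v)"

(* A pseudo null curve on the open interval I together with its Frenet apparatus. The first
   curvature k1 is the constant 0 or 1; unit speed and the nullity of the principal normal are
   the products of F1 and of F2 with themselves. *)
definition pseudo_null_curve ::
  "real set \<Rightarrow> (real \<Rightarrow> real^4) \<Rightarrow> (real \<Rightarrow> real^4) \<Rightarrow> (real \<Rightarrow> real^4) \<Rightarrow> (real \<Rightarrow> real^4)
    \<Rightarrow> (real \<Rightarrow> real^4) \<Rightarrow> real \<Rightarrow> (real \<Rightarrow> real) \<Rightarrow> (real \<Rightarrow> real) \<Rightarrow> bool" where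
  "pseudo_null_curve I \<gamma> F1 F2 F3 F4 k1 k2 k3 \<longleftrightarrow>
     open I \<and> is_interval I \<and> I \<noteq> {} \<and>
     smooth_on I \<gamma> \<and> smooth_on I F1 \<and> smooth_on I F2 \<and> smooth_on I F3 \<and> smooth_on I F4 \<and>
     smooth_on I k2 \<and> smooth_on I k3 \<and>
     k1 = (if straight_line_on I \<gamma> then 0 else 1) \<and>
     (\<forall>s\<in>I.
        minkowski (F1 s) (F1 s) = 1 \<and> minkowski (F3 s) (F3 s) = 1 \<and> minkowski (F2 s) (F4 s) = 1 \<and>
        minkowski (F2 s) (F2 s) = 0 \<and> minkowski (F4 s) (F4 s) = 0 \<and>
        minkowski (F1 s) (F2 s) = 0 \<and> minkowski (F1 s) (F3 s) = 0 \<and> minkowski (F1 s) (F4 s) = 0 \<and>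
        minkowski (F2 s) (F3 s) = 0 \<and> minkowski (F3 s) (F4 s) = 0 \<and>
        (\<gamma> has_vector_derivative F1 s) (at s) \<and>
        (F1 has_vector_derivative k1 *\<^sub>R F2 s) (at s) \<and>
        (F2 has_vector_derivative k2 s *\<^sub>R F3 s) (at s) \<and>
        (F3 has_vector_derivative k3 s *\<^sub>R F2 s - k2 s *\<^sub>R F4 s) (at s) \<and>
        (F4 has_vector_derivative - (k1 *\<^sub>R F1 s) - k3 s *\<^sub>R F3 s) (at s))"

definition partial_deriv :: "'n \<Rightarrow> (real^'n \<Rightarrow> 'b::real_normed_vector) \<Rightarrow> real^'n \<Rightarrow> 'b" where
  "partial_deriv i F u = vector_derivative (\<lambda>x. F (u + x *\<^sub>R axis i 1)) (at 0)"

definition first_form :: "(real^3 \<Rightarrow> real^4) \<Rightarrow> real^3 \<Rightarrow> real^3^3" where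
  "first_form \<Omega> u = (\<chi> i j. minkowski (partial_deriv i \<Omega> u) (partial_deriv j \<Omega> u))"

definition second_form :: "(real^3 \<Rightarrow> real^4) \<Rightarrow> (real^3 \<Rightarrow> real^4) \<Rightarrow> real^3 \<Rightarrow> real^3^3" where
  "second_form \<Omega> N u = (\<chi> i j. minkowski (partial_deriv j (partial_deriv i \<Omega>) u) (N u))"

definition regular_points :: "(real^3 \<Rightarrow> real^4) \<Rightarrow> (real^3) set \<Rightarrow> (real^3) set" where
  "regular_points \<Omega> D = {u\<in>D. det (first_form \<Omega> u) \<noteq> 0}"

(* Continuity rules out pointwise arbitrary choices between N and -N. *)
definition unit_normal_on :: "(real^3) set \<Rightarrow> (real^3 \<Rightarrow> real^4) \<Rightarrow> (real^3 \<Rightarrow> real^4) \<Rightarrow> bool" where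
  "unit_normal_on D \<Omega> N \<longleftrightarrow> continuous_on D N \<and>
     (\<forall>u\<in>D. minkowski (N u) (N u) \<in> {1, -1} \<and> (\<forall>i. minkowski (N u) (partial_deriv i \<Omega> u) = 0))"

definition shape_matrix :: "(real^3 \<Rightarrow> real^4) \<Rightarrow> (real^3 \<Rightarrow> real^4) \<Rightarrow> real^3 \<Rightarrow> real^3^3" where
  "shape_matrix \<Omega> N u = matrix_inv (first_form \<Omega> u) ** second_form \<Omega> N u"

definition gaussian_curvature :: "(real^3 \<Rightarrow> real^4) \<Rightarrow> (real^3 \<Rightarrow> real^4) \<Rightarrow> real^3 \<Rightarrow> real" where
  "gaussian_curvature \<Omega> N u =
     minkowski (N u) (N u) * det (second_form \<Omega> N u) / det (first_form \<Omega> u)"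

definition mean_curvature :: "(real^3 \<Rightarrow> real^4) \<Rightarrow> (real^3 \<Rightarrow> real^4) \<Rightarrow> real^3 \<Rightarrow> real" where
  "mean_curvature \<Omega> N u = trace (shape_matrix \<Omega> N u) / (3 * minkowski (N u) (N u))"

(* Differentiability is demanded so that the partial derivatives are meaningful. *)
definition HK_weingarten ::
  "3 \<Rightarrow> 3 \<Rightarrow> (real^3) set \<Rightarrow> (real^3 \<Rightarrow> real^4) \<Rightarrow> (real^3 \<Rightarrow> real^4) \<Rightarrow> bool" where
  "HK_weingarten x y D \<Omega> N \<longleftrightarrow>
     (let H = mean_curvature \<Omega> N; K = gaussian_curvature \<Omega> N in
      \<forall>u\<in>D. H differentiable (at u) \<and> K differentiable (at u) \<and>
        partial_deriv x H u * partial_deriv y K u - partial_deriv y H u * partial_deriv x K u = 0)"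

(* In the tubes the parameters (s, t, w) are the coordinates 1, 2, 3 of u;
   \<sigma> is 1 for the upper sign of the formula and -1 for the lower one. *)
definition tube1 where
  "tube1 \<gamma> F2 F3 F4 f g r \<sigma> (u::real^3) =
     (let s = u$1; a = f (u$2, u$3) :: real; b = g (u$2, u$3) in
      \<gamma> s - (\<sigma> * r) *\<^sub>R ((b * sin a) *\<^sub>R F2 s + cos a *\<^sub>R F3 s + (sin a / (2 * b)) *\<^sub>R F4 s) :: real^4)"

definition tube2 where
  "tube2 \<gamma> F2 F3 F4 f g r \<sigma> (u::real^3) =
     (let s = u$1; a = f (u$2, u$3) :: real; b = g (u$2, u$3) in
      \<gamma> s - (\<sigma> * r) *\<^sub>R ((b * cos a) *\<^sub>R F2 s + sin a *\<^sub>R F3 s + (cos a / (2 * b)) *\<^sub>R F4 s) :: real^4)"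

definition tube3 where
  "tube3 \<gamma> F2 F3 F4 f g r \<sigma> (u::real^3) =
     (let s = u$1; a = f (u$2, u$3) :: real; b = g (u$2, u$3) in
      \<gamma> s - (\<sigma> * r) *\<^sub>R ((b * sinh a) *\<^sub>R F2 s + cosh a *\<^sub>R F3 s - (sinh a / (2 * b)) *\<^sub>R F4 s) :: real^4)"

definition tube4 where
  "tube4 \<gamma> F2 F3 F4 f g r \<sigma> (u::real^3) =
     (let s = u$1; a = f (u$2, u$3) :: real; b = g (u$2, u$3) in
      \<gamma> s - (\<sigma> * r) *\<^sub>R ((b * cosh a) *\<^sub>R F2 s + sinh a *\<^sub>R F3 s - (cosh a / (2 * b)) *\<^sub>R F4 s) :: real^4)"

definition tube_domain :: "real set \<Rightarrow> (real \<times> real) set \<Rightarrow> (real^3) set" where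
  "tube_domain I U = {u. u$1 \<in> I \<and> (u$2, u$3) \<in> U}"

end

theory Submission
  imports Defs
begin

text \<open>
  Each of the four hypersurfaces has the form \<open>T = \<gamma> + c \<nu>\<close> with a constant \<open>c\<close> and a field \<open>\<nu>\<close> that
  is orthogonal to \<open>F1 = \<gamma>'\<close> and has constant square \<open>\<eta> = \<plusminus>1\<close>. Differentiating these two relations
  shows that \<open>\<nu>\<close> is normal to \<open>T\<close>, and that \<open>\<langle>T\<^sub>i, F1\<rangle>\<close> vanishes except for \<open>i = s\<close>, where it is
  \<open>\<phi> = 1 - c k1 \<langle>\<nu>, F2\<rangle>\<close>. As \<open>\<nu>\<^sub>j\<close> is \<open>T\<^sub>j / c\<close>, up to a correction \<open>- F1 / c\<close> for \<open>j = s\<close>, the second form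
  with respect to \<open>\<nu>\<close> is \<open>h = - (g - \<phi> E) / c\<close>, where \<open>g\<close> is the first form and \<open>E\<close> the matrix unit of
  the corner \<open>(s,s)\<close>: in the two directions around the tube the hypersurface curves like a
  sphere.

  At a regular point the three partial derivatives of \<open>T\<close> and \<open>\<nu>\<close> span the whole space. Expanding the
  unit vector \<open>F1\<close> in this frame gives \<open>\<phi>\<^sup>2 (g\<^sup>-\<^sup>1)\<^sub>s\<^sub>s = 1\<close>. Therefore the trace of \<open>S = g\<^sup>-\<^sup>1 h\<close> and the quotient
  of \<open>det h\<close> by \<open>det g\<close> are both affine functions of the single function \<open>1 / \<phi>\<close>, with constant
  coefficients (lemma \<open>curvatures\<close>). So the gradients of \<open>H\<close> and \<open>K\<close> are proportional, and all
  three Weingarten determinants vanish (lemma \<open>HK_weingarten_if_affine\<close>).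

  Two points need care. A unit normal \<open>N\<close> agrees with \<open>\<nu>\<close> only up to a sign, which is locally constant
  because \<open>N\<close> is continuous. And \<open>\<nu>\<close> has to be differentiable twice, so that the partial derivatives of
  \<open>T\<close> can be differentiated again; this is derived from the smoothness of the frame and of \<open>f\<close>, \<open>g\<close>.
\<close>

section \<open>The Minkowski product and partial derivatives\<close>

lemma bounded_bilinear_minkowski: "bounded_bilinear minkowski"
proof -
  have "bilinear minkowski"
    unfolding bilinear_def
    by (auto simp: minkowski_def algebra_simps intro!: linearI)
  then show ?thesis
    by (simp add: bilinear_conv_bounded_bilinear)
qed

interpretation minkowski: bounded_bilinear minkowski
  by (rule bounded_bilinear_minkowski)

lemma minkowski_commute: "minkowski u v = minkowski v u"
  by (simp add: minkowski_def mult.commute)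

lemma minkowski_nondegenerate:
  assumes "\<And>w. minkowski v w = 0"
  shows "v = 0"
proof -
  have "minkowski v (axis i 1) = 0" for i
    by (rule assms)
  from this[of 1] this[of 2] this[of 3] this[of 4] show ?thesis
    by (simp add: minkowski_def axis_def vec_eq_iff forall_4)
qed

lemma has_derivative_minkowski:
  assumes "(f has_derivative f') (at x within S)" and "(g has_derivative g') (at x within S)"
  shows "((\<lambda>x. minkowski (f x) (g x)) has_derivative
           (\<lambda>h. minkowski (f x) (g' h) + minkowski (f' h) (g x))) (at x within S)"
  by (rule minkowski.FDERIV[OF assms])

lemma differentiable_minkowski:
  assumes "f differentiable (at x within S)" and "g differentiable (at x within S)"
  shows "(\<lambda>x. minkowski (f x) (g x)) differentiable (at x within S)"
  using assms unfolding differentiable_def by (blast intro: has_derivative_minkowski)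

lemma partial_deriv_eq:
  assumes "(F has_derivative F') (at u)"
  shows "partial_deriv i F u = F' (axis i 1)"
proof -
  have "((\<lambda>x::real. u + x *\<^sub>R axis i 1) has_derivative (\<lambda>x. x *\<^sub>R axis i 1)) (at 0)"
    by (auto intro!: derivative_eq_intros)
  from diff_chain_at[OF this, of F F'] assms
  have "((\<lambda>x. F (u + x *\<^sub>R axis i 1)) has_derivative (\<lambda>x. F' (x *\<^sub>R axis i 1))) (at 0)"
    by (simp add: o_def)
  moreover have "F' (x *\<^sub>R axis i 1) = x *\<^sub>R F' (axis i 1)" for x
    using assms by (simp add: has_derivative_def bounded_linear.linear linear_cmul)
  ultimately have "((\<lambda>x. F (u + x *\<^sub>R axis i 1)) has_vector_derivative F' (axis i 1)) (at 0)"
    by (simp add: has_vector_derivative_def)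
  then show ?thesis
    unfolding partial_deriv_def by (rule vector_derivative_at)
qed

section \<open>Twice differentiable maps\<close>

text \<open>
  Only derivatives up to order two occur in the curvatures. Having some field of derivatives whose
  values on fixed vectors are differentiable, instead of speaking about \<open>frechet_derivative\<close>, makes the
  closure properties immediate from the rules for \<open>has_derivative\<close>.
\<close>
definition twice_diff :: "'a::real_normed_vector set \<Rightarrow> ('a \<Rightarrow> 'b::real_normed_vector) \<Rightarrow> bool" where
  "twice_diff S f \<longleftrightarrow> (\<exists>f'. (\<forall>x\<in>S. (f has_derivative f' x) (at x)) \<and>
     (\<forall>v. \<forall>x\<in>S. (\<lambda>y. f' y v) differentiable (at x)))"

lemma twice_diffI:
  assumes "\<And>x. x \<in> S \<Longrightarrow> (f has_derivative f' x) (at x)"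
    and "\<And>v x. x \<in> S \<Longrightarrow> (\<lambda>y. f' y v) differentiable (at x)"
  shows "twice_diff S f"
  using assms unfolding twice_diff_def by blast

lemma twice_diffE:
  assumes "twice_diff S f"
  obtains f' where "\<And>x. x \<in> S \<Longrightarrow> (f has_derivative f' x) (at x)"
    and "\<And>v x. x \<in> S \<Longrightarrow> (\<lambda>y. f' y v) differentiable (at x)"
    and "\<And>x. x \<in> S \<Longrightarrow> f differentiable (at x)"
  using assms unfolding twice_diff_def differentiable_def by blast

lemma twice_diff_smooth:
  assumes "smooth_on S f"
  shows "twice_diff S f"
proof (rule twice_diffI)
  have C2: "Ck_on (Suc (Suc 0)) S f"
    using assms unfolding smooth_on_def by blast
  show "(f has_derivative frechet_derivative f (at x)) (at x)" if "x \<in> S" for x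
    using C2 that by (simp add: frechet_derivative_works)
  show "(\<lambda>y. frechet_derivative f (at y) v) differentiable (at x)" if "x \<in> S" for v x
    using C2 that by simp
qed

lemma twice_diff_const: "twice_diff S (\<lambda>_. c)"
  by (rule twice_diffI[of S _ "\<lambda>_ _. 0"]) simp_all

lemma twice_diff_add:
  assumes "twice_diff S f" and "twice_diff S g"
  shows "twice_diff S (\<lambda>x. f x + g x)"
  using assms
  by (elim twice_diffE) (rule twice_diffI, (rule has_derivative_add; blast), simp)

lemma twice_diff_scaleR:
  assumes "twice_diff S f" and "twice_diff S g"
  shows "twice_diff S (\<lambda>x. f x *\<^sub>R g x)"
  using assms
  by (elim twice_diffE) (rule twice_diffI, (rule has_derivative_scaleR; blast), simp)

lemma twice_diff_mult:
  fixes f g :: "'a::real_normed_vector \<Rightarrow> real"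
  assumes "twice_diff S f" and "twice_diff S g"
  shows "twice_diff S (\<lambda>x. f x * g x)"
  using twice_diff_scaleR[OF assms] by simp

lemma twice_diff_compose_linear:
  assumes "bounded_linear p" and "twice_diff A f" and "\<And>x. x \<in> S \<Longrightarrow> p x \<in> A"
  shows "twice_diff S (\<lambda>x. f (p x))"
proof -
  obtain f' where f': "\<And>x. x \<in> A \<Longrightarrow> (f has_derivative f' x) (at x)"
    "\<And>v x. x \<in> A \<Longrightarrow> (\<lambda>y. f' y v) differentiable (at x)"
    using assms(2) by (elim twice_diffE) blast
  have p: "(p has_derivative p) (at x)" for x
    by (rule bounded_linear_imp_has_derivative[OF assms(1)])
  then have pd: "p differentiable (at x)" for x
    unfolding differentiable_def by blast
  show ?thesis
  proof (rule twice_diffI)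
    show "((\<lambda>x. f (p x)) has_derivative (\<lambda>v. f' (p x) (p v))) (at x)" if "x \<in> S" for x
      using diff_chain_at[OF p f'(1)] assms(3) that by (simp add: o_def)
    show "(\<lambda>y. f' (p y) (p v)) differentiable (at x)" if "x \<in> S" for v x
      using differentiable_chain_at[OF pd f'(2)] assms(3) that by (simp add: o_def)
  qed
qed

lemma twice_diff_compose_real:
  fixes f :: "real \<Rightarrow> real"
  assumes "\<And>x. x \<in> A \<Longrightarrow> (f has_real_derivative f' x) (at x)"
    and "\<And>x. x \<in> A \<Longrightarrow> f' differentiable (at x)"
    and "twice_diff S h" and "\<And>x. x \<in> S \<Longrightarrow> h x \<in> A"
  shows "twice_diff S (\<lambda>x. f (h x))"
proof -
  obtain h' where h': "\<And>x. x \<in> S \<Longrightarrow> (h has_derivative h' x) (at x)"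
    "\<And>v x. x \<in> S \<Longrightarrow> (\<lambda>y. h' y v) differentiable (at x)"
    "\<And>x. x \<in> S \<Longrightarrow> h differentiable (at x)"
    using assms(3) by (elim twice_diffE) blast
  show ?thesis
  proof (rule twice_diffI)
    show "((\<lambda>x. f (h x)) has_derivative (\<lambda>v. f' (h x) * h' x v)) (at x)" if "x \<in> S" for x
      using diff_chain_at[OF h'(1)[OF that]] assms(1)[OF assms(4)[OF that]]
      by (simp add: o_def has_field_derivative_def)
    show "(\<lambda>y. f' (h y) * h' y v) differentiable (at x)" if "x \<in> S" for v x
      using differentiable_chain_at[OF h'(3) assms(2)] h'(2) assms(4) that by (simp add: o_def)
  qed
qed

lemma
  assumes "twice_diff S h"
  shows twice_diff_sin: "twice_diff S (\<lambda>x. sin (h x) :: real)"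
    and twice_diff_cos: "twice_diff S (\<lambda>x. cos (h x) :: real)"
    and twice_diff_sinh: "twice_diff S (\<lambda>x. sinh (h x) :: real)"
    and twice_diff_cosh: "twice_diff S (\<lambda>x. cosh (h x) :: real)"
proof -
  have 1: "(\<lambda>x::real. - sin x) differentiable (at x)" "cos differentiable (at x)"
    "sinh differentiable (at x)" "cosh differentiable (at x)" for x :: real
    unfolding differentiable_def
    by (auto intro!: derivative_eq_intros exI simp: has_field_derivative_def[symmetric])
  show "twice_diff S (\<lambda>x. sin (h x))"
    by (rule twice_diff_compose_real[where A = UNIV, OF DERIV_sin 1(2) assms]) simp
  show "twice_diff S (\<lambda>x. cos (h x))"
    by (rule twice_diff_compose_real[where A = UNIV, OF DERIV_cos 1(1) assms]) simp
  show "twice_diff S (\<lambda>x. sinh (h x))"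
    by (rule twice_diff_compose_real[where A = UNIV and f' = cosh, OF _ 1(4) assms])
      (auto intro!: derivative_eq_intros)
  show "twice_diff S (\<lambda>x. cosh (h x))"
    by (rule twice_diff_compose_real[where A = UNIV and f' = sinh, OF _ 1(3) assms])
      (auto intro!: derivative_eq_intros)
qed

lemma twice_diff_divide:
  fixes f h :: "'a::real_normed_vector \<Rightarrow> real"
  assumes "twice_diff S f" and "twice_diff S h" and "\<And>x. x \<in> S \<Longrightarrow> h x \<noteq> 0"
  shows "twice_diff S (\<lambda>x. f x / h x)"
proof -
  have "twice_diff S (\<lambda>x. inverse (h x))"
    by (rule twice_diff_compose_real[where A = "-{0}" and f' = "\<lambda>x. - (inverse x * inverse x)"])
      (use assms in \<open>auto intro!: derivative_eq_intros\<close>)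
  from twice_diff_mult[OF assms(1) this] show ?thesis
    by (simp add: divide_inverse)
qed

section \<open>Perturbing a matrix in one corner\<close>

lemma matrix_inv_det_nz:
  fixes g :: "real^'n^'n"
  assumes "det g \<noteq> 0"
  shows "g ** matrix_inv g = mat 1" and "matrix_inv g ** g = mat 1"
proof -
  have "\<exists>G. g ** G = mat 1 \<and> G ** g = mat 1"
    using assms by (simp add: invertible_det_nz[symmetric] invertible_def)
  from someI_ex[OF this] show "g ** matrix_inv g = mat 1" "matrix_inv g ** g = mat 1"
    unfolding matrix_inv_def by blast+
qed

text \<open>
  The product of the inverse of \<open>g\<close> with \<open>h\<close> is \<open>m\<close> times an identity matrix whose first column has been
  changed, so that its trace and its determinant can be read off.
\<close>
lemma corner_perturbation:
  fixes g h :: "real^3^3"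
  assumes "det g \<noteq> 0"
    and h: "\<And>i j. h $ i $ j = m * (g $ i $ j - (if i = 1 \<and> j = 1 then p else 0))"
  shows "trace (matrix_inv g ** h) = m * (3 - p * matrix_inv g $ 1 $ 1)"
    and "det h = m ^ 3 * det g * (1 - p * matrix_inv g $ 1 $ 1)"
proof -
  define G where "G = matrix_inv g"
  have gG: "g ** G = mat 1" and Gg: "G ** g = mat 1"
    using matrix_inv_det_nz[OF assms(1)] by (simp_all add: G_def)
  have Gh: "(G ** h) $ i $ j = m * ((if i = j then 1 else 0) - (if j = 1 then p * G $ i $ 1 else 0))"
    for i j
  proof -
    have "(G ** h) $ i $ j = m * ((G ** g) $ i $ j - (if j = 1 then p * G $ i $ 1 else 0))"
      by (simp add: matrix_matrix_mult_def sum_3 h algebra_simps)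
    then show ?thesis
      by (simp add: Gg mat_def)
  qed
  show "trace (matrix_inv g ** h) = m * (3 - p * matrix_inv g $ 1 $ 1)"
    by (simp add: trace_def sum_3 G_def[symmetric] Gh algebra_simps)
  have "det h = det ((g ** G) ** h)"
    by (simp add: gG)
  also have "\<dots> = det g * det (G ** h)"
    by (simp add: matrix_mul_assoc[symmetric] det_mul)
  also have "det (G ** h) = m ^ 3 * (1 - p * G $ 1 $ 1)"
    by (simp add: det_3 Gh power3_eq_cube algebra_simps)
  finally show "det h = m ^ 3 * det g * (1 - p * matrix_inv g $ 1 $ 1)"
    by (simp add: G_def)
qed

section \<open>Curvatures that depend on one function\<close>

text \<open>
  If near each point both curvatures are affine in the same function \<open>\<psi>\<close>, then their gradients are
  multiples of the gradient of \<open>\<psi>\<close>. The coefficients may change from point to point, as the sign of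
  the normal does on different components of the regular set.
\<close>
lemma HK_weingarten_if_affine:
  assumes "\<And>u. u \<in> D \<Longrightarrow> \<exists>\<psi> a b a' b'. \<psi> differentiable (at u) \<and>
     (\<forall>\<^sub>F v in nhds u. mean_curvature T N v = a + b * \<psi> v \<and>
        gaussian_curvature T N v = a' + b' * \<psi> v)"
  shows "HK_weingarten x y D T N"
  unfolding HK_weingarten_def Let_def
proof
  fix u assume "u \<in> D"
  from assms[OF this] obtain \<psi> a b a' b' \<psi>' S where
    d: "(\<psi> has_derivative \<psi>') (at u)" and S: "open S" "u \<in> S"
    and H: "\<And>v. v \<in> S \<Longrightarrow> a + b * \<psi> v = mean_curvature T N v"
    and K: "\<And>v. v \<in> S \<Longrightarrow> a' + b' * \<psi> v = gaussian_curvature T N v"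
    unfolding eventually_nhds differentiable_def by metis
  have "((\<lambda>v. a + b * \<psi> v) has_derivative (\<lambda>h. b * \<psi>' h)) (at u)"
    "((\<lambda>v. a' + b' * \<psi> v) has_derivative (\<lambda>h. b' * \<psi>' h)) (at u)"
    by (auto intro!: derivative_eq_intros d)
  then have dH: "(mean_curvature T N has_derivative (\<lambda>h. b * \<psi>' h)) (at u)"
    and dK: "(gaussian_curvature T N has_derivative (\<lambda>h. b' * \<psi>' h)) (at u)"
    by (auto intro: has_derivative_transform_within_open[OF _ S H]
        has_derivative_transform_within_open[OF _ S K])
  show "mean_curvature T N differentiable at u \<and> gaussian_curvature T N differentiable at u \<and>
      partial_deriv x (mean_curvature T N) u * partial_deriv y (gaussian_curvature T N) u -
      partial_deriv y (mean_curvature T N) u * partial_deriv x (gaussian_curvature T N) u = 0"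
    using dH dK by (auto simp: differentiable_def partial_deriv_eq[OF dH] partial_deriv_eq[OF dK])
qed

section \<open>Geometry of a tubular hypersurface\<close>

lemma has_derivative_along_curve:
  assumes "(f has_vector_derivative f') (at (u $ 1))"
  shows "((\<lambda>u::real^3. f (u $ 1)) has_derivative (\<lambda>v. v $ 1 *\<^sub>R f')) (at u)"
proof -
  have "((\<lambda>u::real^3. u $ 1) has_derivative (\<lambda>v. v $ 1)) (at u)"
    by (rule bounded_linear_imp_has_derivative[OF bounded_linear_vec_nth])
  from diff_chain_at[OF this, of f] assms show ?thesis
    by (simp add: o_def has_vector_derivative_def)
qed

text \<open>
  A hypersurface \<open>\<gamma> + c \<nu>\<close> at constant distance from a curve, where \<open>\<nu>\<close> may be spacelike or timelike.
  In the application \<open>c\<close> is minus the signed radius, \<open>W\<close> is the parameter domain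
  and \<open>\<nu>\<close> is the combination of \<open>F2\<close>, \<open>F3\<close>, \<open>F4\<close> that is attached to the curve.
\<close>
locale tubular_hypersurface =
  fixes \<gamma> F1 F2 :: "real \<Rightarrow> real^4" and k c \<eta> :: real and W :: "(real^3) set"
    and \<nu> :: "real^3 \<Rightarrow> real^4" and \<nu>' :: "real^3 \<Rightarrow> real^3 \<Rightarrow> real^4"
  assumes open_W: "open W"
    and c_nz: "c \<noteq> 0" and eta_cases: "\<eta> \<in> {1, -1}"
    and \<gamma>_deriv: "u \<in> W \<Longrightarrow> (\<gamma> has_vector_derivative F1 (u $ 1)) (at (u $ 1))"
    and F1_deriv: "u \<in> W \<Longrightarrow> (F1 has_vector_derivative k *\<^sub>R F2 (u $ 1)) (at (u $ 1))"
    and F2_diff: "u \<in> W \<Longrightarrow> F2 differentiable (at (u $ 1))"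
    and \<nu>_deriv: "u \<in> W \<Longrightarrow> (\<nu> has_derivative \<nu>' u) (at u)"
    and \<nu>'_diff: "u \<in> W \<Longrightarrow> (\<lambda>y. \<nu>' y v) differentiable (at u)"
    and F1_unit: "u \<in> W \<Longrightarrow> minkowski (F1 (u $ 1)) (F1 (u $ 1)) = 1"
    and \<nu>_unit: "u \<in> W \<Longrightarrow> minkowski (\<nu> u) (\<nu> u) = \<eta>"
    and \<nu>_F1: "u \<in> W \<Longrightarrow> minkowski (\<nu> u) (F1 (u $ 1)) = 0"
begin

definition T :: "real^3 \<Rightarrow> real^4" where
  "T u = \<gamma> (u $ 1) + c *\<^sub>R \<nu> u"

text \<open>This is the component along \<open>F1\<close> of the partial derivative \<open>T\<^sub>s\<close>, see \<open>partial_T_F1\<close>.\<close>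
definition \<phi> :: "real^3 \<Rightarrow> real" where
  "\<phi> u = 1 - c * k * minkowski (\<nu> u) (F2 (u $ 1))"

lemma eta_sq: "\<eta> * \<eta> = 1"
  using eta_cases by auto

lemma T_deriv:
  assumes "u \<in> W"
  shows "(T has_derivative (\<lambda>v. v $ 1 *\<^sub>R F1 (u $ 1) + c *\<^sub>R \<nu>' u v)) (at u)"
  unfolding T_def
  by (rule has_derivative_add has_derivative_along_curve has_derivative_scaleR_right
      \<gamma>_deriv \<nu>_deriv assms)+

lemma partial_T:
  assumes "u \<in> W"
  shows "partial_deriv i T u = axis i 1 $ 1 *\<^sub>R F1 (u $ 1) + c *\<^sub>R \<nu>' u (axis i 1)"
  by (rule partial_deriv_eq[OF T_deriv[OF assms]])

lemma partial_T_differentiable: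
  assumes "u \<in> W"
  shows "partial_deriv i T differentiable (at u)"
proof -
  have "(\<lambda>u::real^3. F1 (u $ 1)) differentiable (at u)"
    using has_derivative_along_curve[OF F1_deriv[OF assms]] unfolding differentiable_def by blast
  then have "(\<lambda>u. axis i 1 $ 1 *\<^sub>R F1 (u $ 1) + c *\<^sub>R \<nu>' u (axis i 1)) differentiable (at u)"
    using \<nu>'_diff[OF assms] by simp
  then show ?thesis
    unfolding differentiable_def
    by (metis (no_types, lifting) has_derivative_transform_within_open[OF _ open_W assms] partial_T)
qed

text \<open>
  The products \<open>\<langle>\<nu>, \<nu>\<rangle>\<close>, \<open>\<langle>\<nu>, F1\<rangle>\<close> and \<open>\<langle>T\<^sub>i, \<nu>\<rangle>\<close> are constant on \<open>W\<close>. Differentiating them yields in turn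
  that \<open>\<nu>\<close> is normal to the tube, the value of \<open>\<langle>T\<^sub>i, F1\<rangle>\<close>, and the second form.
\<close>
lemma minkowski_const_deriv:
  assumes "u \<in> W" and "(f has_derivative f') (at u)" and "(g has_derivative g') (at u)"
    and "\<And>u. u \<in> W \<Longrightarrow> minkowski (f u) (g u) = const"
  shows "minkowski (f' v) (g u) = - minkowski (f u) (g' v)"
proof -
  have "((\<lambda>u. minkowski (f u) (g u)) has_derivative
      (\<lambda>h. minkowski (f u) (g' h) + minkowski (f' h) (g u))) (at u)"
    by (rule has_derivative_minkowski[OF assms(2,3)])
  moreover have "((\<lambda>u. minkowski (f u) (g u)) has_derivative (\<lambda>_. 0)) (at u)"
    by (rule has_derivative_transform_within_open[OF has_derivative_const[of const] open_W assms(1)])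
      (simp add: assms(4))
  ultimately have "(\<lambda>h. minkowski (f u) (g' h) + minkowski (f' h) (g u)) = (\<lambda>_. 0)"
    by (rule has_derivative_unique)
  from fun_cong[OF this, of v] show ?thesis
    by simp
qed

lemma \<nu>'_\<nu>:
  assumes "u \<in> W"
  shows "minkowski (\<nu>' u v) (\<nu> u) = 0"
  using minkowski_const_deriv[OF assms \<nu>_deriv[OF assms] \<nu>_deriv[OF assms] \<nu>_unit, of v]
  by (simp add: minkowski_commute)

lemma \<nu>'_F1:
  assumes "u \<in> W"
  shows "minkowski (\<nu>' u v) (F1 (u $ 1)) = - (v $ 1 * k * minkowski (\<nu> u) (F2 (u $ 1)))"
  using minkowski_const_deriv[OF assms \<nu>_deriv[OF assms]
      has_derivative_along_curve[OF F1_deriv[OF assms]] \<nu>_F1, of v]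
  by (simp add: minkowski.scaleR_right)

lemma partial_T_F1:
  assumes "u \<in> W"
  shows "minkowski (partial_deriv i T u) (F1 (u $ 1)) = (if i = 1 then \<phi> u else 0)"
  by (simp add: partial_T[OF assms] \<phi>_def minkowski.add_left minkowski.scaleR_left
      F1_unit[OF assms] \<nu>'_F1[OF assms] axis_def)

lemma partial_T_\<nu>:
  assumes "u \<in> W"
  shows "minkowski (partial_deriv i T u) (\<nu> u) = 0"
  by (simp add: partial_T[OF assms] minkowski.add_left minkowski.scaleR_left
      \<nu>_F1[OF assms, unfolded minkowski_commute[of "\<nu> u"]] \<nu>'_\<nu>[OF assms])

text \<open>
  Differentiating \<open>\<langle>T\<^sub>i, \<nu>\<rangle> = 0\<close> moves the second derivative onto \<open>\<nu>\<close>, and \<open>\<nu>\<^sub>j\<close> is known from \<open>T\<^sub>j\<close> and \<open>F1\<close>. This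
  gives the second form without computing a second derivative of \<open>T\<close>.
\<close>
lemma second_partial_T_\<nu>:
  assumes "u \<in> W"
  shows "minkowski (partial_deriv j (partial_deriv i T) u) (\<nu> u) =
    - (first_form T u $ i $ j - (if i = 1 \<and> j = 1 then \<phi> u else 0)) / c"
proof -
  obtain D where D: "(partial_deriv i T has_derivative D) (at u)"
    using partial_T_differentiable[OF assms] unfolding differentiable_def by blast
  have "minkowski (partial_deriv j (partial_deriv i T) u) (\<nu> u) =
      - minkowski (partial_deriv i T u) (\<nu>' u (axis j 1))"
    unfolding partial_deriv_eq[OF D]
    by (rule minkowski_const_deriv[OF assms D \<nu>_deriv[OF assms] partial_T_\<nu>])
  also have "\<nu>' u (axis j 1) = (1 / c) *\<^sub>R (partial_deriv j T u - axis j 1 $ 1 *\<^sub>R F1 (u $ 1))"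
    using c_nz by (simp add: partial_T[OF assms])
  also have "- minkowski (partial_deriv i T u) \<dots> =
      - (first_form T u $ i $ j - (if i = 1 \<and> j = 1 then \<phi> u else 0)) / c"
    by (simp add: minkowski.scaleR_right minkowski.diff_right partial_T_F1[OF assms]
        first_form_def axis_def minus_divide_left)
  finally show ?thesis .
qed

text \<open>
  The Gram matrix of \<open>T\<^sub>s, T\<^sub>t, T\<^sub>w, \<nu>\<close> has the blocks \<open>g\<close> and \<open>\<eta>\<close>, both invertible. So these four vectors are
  independent and span the whole space, on which the product is nondegenerate.
\<close>
lemma orthogonal_to_frame_eq_0:
  assumes "u \<in> W" and "det (first_form T u) \<noteq> 0"
    and "\<And>i. minkowski v (partial_deriv i T u) = 0" and "minkowski v (\<nu> u) = 0"
  shows "v = 0"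
proof -
  define L where "L = (\<lambda>p :: (real^3) \<times> real.
    (\<Sum>i\<in>UNIV. fst p $ i *\<^sub>R partial_deriv i T u) + snd p *\<^sub>R \<nu> u)"
  have "linear L"
    unfolding L_def
    by (rule linearI)
      (simp_all add: sum.distrib scaleR_add_left scaleR_add_right scaleR_sum_right)
  moreover have "inj L"
    unfolding linear_injective_0[OF \<open>linear L\<close>]
  proof (intro allI impI)
    fix p assume "L p = 0"
    obtain x y where p: "p = (x, y)"
      by fastforce
    have "minkowski (partial_deriv j T u) (L p) = (first_form T u *v x) $ j" for j
      by (simp add: L_def p minkowski.add_right minkowski.sum_right minkowski.scaleR_right
          partial_T_\<nu>[OF assms(1)] matrix_vector_mult_def first_form_def mult.commute)
    then have "first_form T u *v x = 0"
      using \<open>L p = 0\<close> by (simp add: vec_eq_iff minkowski.zero_right)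
    then have "x = 0"
      using matrix_inv_det_nz(2)[OF assms(2)] matrix_left_invertible_ker by blast
    then have "y * \<eta> = minkowski (L p) (\<nu> u)"
      by (simp add: L_def p minkowski.scaleR_left \<nu>_unit[OF assms(1)])
    then show "p = 0"
      using \<open>L p = 0\<close> \<open>x = 0\<close> eta_sq by (auto simp: p minkowski.zero_left zero_prod_def)
  qed
  ultimately have "surj L"
    by (rule eucl.linear_injective_imp_surjective) (simp_all add: dim_UNIV)
  have "minkowski v (L p) = 0" for p
    by (simp add: L_def minkowski.add_right minkowski.sum_right minkowski.scaleR_right assms(3,4))
  then show "v = 0"
    using \<open>surj L\<close> by (metis minkowski_nondegenerate surjD)
qed

text \<open>
  By duality, \<open>F1\<close> equals \<open>\<phi>\<close> times the combination of \<open>T\<^sub>s, T\<^sub>t, T\<^sub>w\<close> whose coefficients are the first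
  column of the inverse of \<open>g\<close>: both sides have the same products with the frame. Pairing this
  expansion with the unit vector \<open>F1\<close> leaves only the corner entry. In particular \<open>\<phi>\<close> is nonzero at
  regular points.
\<close>
lemma inverse_first_form_corner:
  assumes "u \<in> W" and "det (first_form T u) \<noteq> 0"
  shows "\<phi> u * (\<phi> u * matrix_inv (first_form T u) $ 1 $ 1) = 1"
proof -
  let ?G = "matrix_inv (first_form T u)"
  \<comment> \<open>the difference between \<open>F1\<close> and its claimed expansion\<close>
  define w where "w = F1 (u $ 1) - (\<Sum>i\<in>UNIV. (\<phi> u * ?G $ i $ 1) *\<^sub>R partial_deriv i T u)"
  have "minkowski w (partial_deriv j T u) = 0" for j
  proof -
    have "(\<Sum>i\<in>UNIV. first_form T u $ j $ i * ?G $ i $ 1) = (if j = 1 then 1 else 0)"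
      using arg_cong[where f="\<lambda>M. M $ j $ 1", OF matrix_inv_det_nz(1)[OF assms(2)]]
      by (simp add: matrix_matrix_mult_def mat_def)
    moreover have "minkowski w (partial_deriv j T u) = (if j = 1 then \<phi> u else 0) -
        \<phi> u * (\<Sum>i\<in>UNIV. first_form T u $ j $ i * ?G $ i $ 1)"
      unfolding minkowski_commute[of w]
      by (simp add: w_def minkowski.diff_right minkowski.sum_right minkowski.scaleR_right
          partial_T_F1[OF assms(1)] first_form_def sum_distrib_left mult_ac)
    ultimately show ?thesis
      by simp
  qed
  moreover have "minkowski w (\<nu> u) = 0"
    by (simp add: w_def minkowski.diff_left minkowski.sum_left minkowski.scaleR_left
        partial_T_\<nu>[OF assms(1)] \<nu>_F1[OF assms(1), unfolded minkowski_commute[of "\<nu> u"]])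
  ultimately have "w = 0"
    by (rule orthogonal_to_frame_eq_0[OF assms])
  then have "minkowski w (F1 (u $ 1)) = 0"
    by (simp add: minkowski.zero_left)
  then show ?thesis
    by (simp add: w_def minkowski.diff_left minkowski.sum_left minkowski.scaleR_left
        partial_T_F1[OF assms(1)] F1_unit[OF assms(1)] if_distrib mult_ac cong: if_cong)
qed

lemma normal_eq:
  assumes "u \<in> W" and "det (first_form T u) \<noteq> 0"
    and "\<And>i. minkowski n (partial_deriv i T u) = 0"
  shows "n = (\<eta> * minkowski n (\<nu> u)) *\<^sub>R \<nu> u"
proof -
  have "n - (\<eta> * minkowski n (\<nu> u)) *\<^sub>R \<nu> u = 0"
  proof (rule orthogonal_to_frame_eq_0[OF assms(1,2)])
    show "minkowski (n - (\<eta> * minkowski n (\<nu> u)) *\<^sub>R \<nu> u) (partial_deriv i T u) = 0" for i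
      by (simp add: minkowski.diff_left minkowski.scaleR_left assms(3)
          partial_T_\<nu>[OF assms(1), unfolded minkowski_commute[of _ "\<nu> u"]])
    show "minkowski (n - (\<eta> * minkowski n (\<nu> u)) *\<^sub>R \<nu> u) (\<nu> u) = 0"
      using eta_sq by (simp add: minkowski.diff_left minkowski.scaleR_left \<nu>_unit[OF assms(1)])
  qed
  then show ?thesis
    by simp
qed

text \<open>
  By \<open>second_partial_T_\<nu>\<close> the second form is \<open>- l / c\<close> times a perturbation of the first form by \<open>- \<phi>\<close> in
  the corner, and by \<open>inverse_first_form_corner\<close> the perturbation contributes \<open>\<phi> (g\<^sup>-\<^sup>1)\<^sub>1\<^sub>1 = 1 / \<phi>\<close>.
\<close>
lemma curvatures:
  assumes "u \<in> W" and "det (first_form T u) \<noteq> 0"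
    and N: "N u = l *\<^sub>R \<nu> u" and "l * l = 1"
  shows "mean_curvature T N u = - l / (3 * \<eta> * c) * (3 - 1 / \<phi> u)"
    and "gaussian_curvature T N u = - \<eta> * (l / c) ^ 3 * (1 - 1 / \<phi> u)"
proof -
  have sign: "l * (- x / c) = - (l / c) * x" for x
    by simp
  have h: "second_form T N u $ i $ j =
      - (l / c) * (first_form T u $ i $ j - (if i = 1 \<and> j = 1 then \<phi> u else 0))" for i j
    unfolding sign[symmetric] second_partial_T_\<nu>[OF assms(1), symmetric]
    by (simp add: second_form_def N minkowski.scaleR_right)
  have q: "\<phi> u * matrix_inv (first_form T u) $ 1 $ 1 = 1 / \<phi> u"
    using inverse_unique[OF inverse_first_form_corner[OF assms(1,2)]]
    by (simp add: inverse_eq_divide)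
  have \<epsilon>: "minkowski (N u) (N u) = \<eta>"
    using assms(4)
    by (simp add: N minkowski.scaleR_left minkowski.scaleR_right \<nu>_unit[OF assms(1)] mult.assoc[symmetric])
  show "mean_curvature T N u = - l / (3 * \<eta> * c) * (3 - 1 / \<phi> u)"
    unfolding mean_curvature_def shape_matrix_def \<epsilon> corner_perturbation(1)[OF assms(2) h] q
    by simp
  show "gaussian_curvature T N u = - \<eta> * (l / c) ^ 3 * (1 - 1 / \<phi> u)"
    unfolding gaussian_curvature_def \<epsilon> corner_perturbation(2)[OF assms(2) h] q
    using assms(2) by (simp add: power3_eq_cube)
qed

lemma open_regular_points: "open (regular_points T W)"
proof -
  have "continuous_on W (partial_deriv i T)" for i
    using partial_T_differentiable
    by (auto intro!: continuous_at_imp_continuous_on differentiable_imp_continuous_within)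
  then have "continuous_on W (\<lambda>u. det (first_form T u))"
    unfolding det_3 first_form_def
    by (auto intro!: continuous_intros minkowski.continuous_on)
  from continuous_open_preimage[OF this open_W open_Compl[OF closed_singleton[of 0]]]
  have "open (W \<inter> (\<lambda>u. det (first_form T u)) -` (-{0}))"
    by blast
  also have "W \<inter> (\<lambda>u. det (first_form T u)) -` (-{0}) = regular_points T W"
    by (auto simp: regular_points_def)
  finally show ?thesis .
qed

lemma \<phi>_differentiable:
  assumes "u \<in> W"
  shows "\<phi> differentiable (at u)"
proof -
  have "(\<lambda>u::real^3. F2 (u $ 1)) differentiable (at u)"
    using has_derivative_along_curve[OF vector_derivative_works[THEN iffD1, OF F2_diff[OF assms]]]
    unfolding differentiable_def by blast
  moreover have "\<nu> differentiable (at u)"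
    using \<nu>_deriv[OF assms] unfolding differentiable_def by blast
  ultimately show ?thesis
    unfolding \<phi>_def by (intro derivative_intros differentiable_minkowski)
qed

lemma tube_HK_weingarten:
  assumes "unit_normal_on (regular_points T W) T N"
  shows "HK_weingarten x y (regular_points T W) T N"
proof (rule HK_weingarten_if_affine)
  let ?D = "regular_points T W"
  fix u assume u: "u \<in> ?D"
  \<comment> \<open>the sign by which \<open>N\<close> differs from \<open>\<nu>\<close>\<close>
  define l where "l = (\<lambda>v. \<eta> * minkowski (N v) (\<nu> v))"
  have W: "v \<in> W" and det: "det (first_form T v) \<noteq> 0" if "v \<in> ?D" for v
    using that by (auto simp: regular_points_def)
  have N: "N v = l v *\<^sub>R \<nu> v" if "v \<in> ?D" for v
    unfolding l_def using assms that
    by (intro normal_eq) (auto simp: unit_normal_on_def regular_points_def)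
  have l: "l v * l v = 1" if "v \<in> ?D" for v
  proof -
    have "minkowski (N v) (N v) \<in> {1, -1}"
      using assms that unfolding unit_normal_on_def by blast
    moreover have "minkowski (N v) (N v) = (l v * l v) * \<eta>"
      by (simp add: N[OF that] minkowski.scaleR_left minkowski.scaleR_right \<nu>_unit[OF W[OF that]])
    \<comment> \<open>a real square, so \<open>N\<close> must have the same causal character as \<open>\<nu>\<close>\<close>
    moreover have "l v * l v \<noteq> - 1"
      using zero_le_square[of "l v"] by linarith
    ultimately show ?thesis
      using eta_cases by auto
  qed
  have "continuous_on ?D \<nu>"
    using \<nu>_deriv W
    by (intro continuous_at_imp_continuous_on ballI) (blast intro: has_derivative_continuous)
  then have "continuous_on ?D l"
    using assms unfolding l_def unit_normal_on_def
    by (auto intro!: continuous_intros minkowski.continuous_on)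
  then have "isCont l u"
    using u open_regular_points by (simp add: continuous_on_eq_continuous_at)
  \<comment> \<open>two values in \<open>{1, -1}\<close> at distance less than 1 coincide\<close>
  then have "\<forall>\<^sub>F v in nhds u. dist (l v) (l u) < 1"
    unfolding isCont_def tendsto_at_iff_tendsto_nhds by (rule tendstoD) simp
  moreover have "\<forall>\<^sub>F v in nhds u. v \<in> ?D"
    using u open_regular_points by (rule eventually_nhds_in_open[rotated])
  ultimately have "\<forall>\<^sub>F v in nhds u. v \<in> ?D \<and> l v = l u"
  proof eventually_elim
    case (elim v)
    have "l v = 1 \<or> l v = -1" "l u = 1 \<or> l u = -1"
      using l[OF elim(2)] l[OF u] by (auto simp: square_eq_1_iff)
    then show ?case
      using elim by (auto simp: dist_real_def)
  qed
  then have "\<forall>\<^sub>F v in nhds u.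
      mean_curvature T N v = - l u / (\<eta> * c) + l u / (3 * \<eta> * c) * (1 / \<phi> v) \<and>
      gaussian_curvature T N v = - \<eta> * (l u / c) ^ 3 + \<eta> * (l u / c) ^ 3 * (1 / \<phi> v)"
  proof eventually_elim
    case (elim v)
    then have v: "v \<in> ?D" and "l v = l u"
      by auto
    then have "N v = l u *\<^sub>R \<nu> v" "l u * l u = 1"
      using N l by metis+
    from curvatures[of v N, OF W[OF v] det[OF v] this] show ?case
      by (simp add: algebra_simps)
  qed
  moreover have "\<phi> u \<noteq> 0"
    using inverse_first_form_corner[OF W[OF u] det[OF u]] by auto
  then have "(\<lambda>v. 1 / \<phi> v) differentiable (at u)"
    using \<phi>_differentiable[OF W[OF u]] by simp
  ultimately show "\<exists>\<psi> a b a' b'. \<psi> differentiable (at u) \<and>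
     (\<forall>\<^sub>F v in nhds u. mean_curvature T N v = a + b * \<psi> v \<and>
        gaussian_curvature T N v = a' + b' * \<psi> v)"
    by (intro exI[of _ "\<lambda>v. 1 / \<phi> v"] exI conjI)
qed

end

section \<open>Tubes around pseudo null curves\<close>

text \<open>
  Since \<open>F2\<close> and \<open>F4\<close> are null with product 1 and \<open>F3\<close> is a unit vector orthogonal to both, a field
  \<open>A F2 + B F3 + C F4\<close> has the square \<open>B\<^sup>2 + 2 A C\<close>.
\<close>
lemma tube_weingarten:
  fixes \<gamma> F1 F2 F3 F4 :: "real \<Rightarrow> real^4" and A B C :: "real^3 \<Rightarrow> real"
  assumes frame: "pseudo_null_curve I \<gamma> F1 F2 F3 F4 k1 k2 k3"
    and "c \<noteq> 0" and "open W" and I: "\<And>u. u \<in> W \<Longrightarrow> u $ 1 \<in> I"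
    and "twice_diff W A" and "twice_diff W B" and "twice_diff W C"
    and norm: "\<eta> \<in> {1, -1}" "\<And>u. u \<in> W \<Longrightarrow> (B u)\<^sup>2 + 2 * A u * C u = \<eta>"
    and T: "\<And>u. T u = \<gamma> (u $ 1) +
      c *\<^sub>R (A u *\<^sub>R F2 (u $ 1) + B u *\<^sub>R F3 (u $ 1) + C u *\<^sub>R F4 (u $ 1))"
    and normal: "unit_normal_on (regular_points T W) T N"
  shows "HK_weingarten x y (regular_points T W) T N"
proof -
  define \<nu> where "\<nu> u = A u *\<^sub>R F2 (u $ 1) + B u *\<^sub>R F3 (u $ 1) + C u *\<^sub>R F4 (u $ 1)" for u
  have sm: "twice_diff I F2" "twice_diff I F3" "twice_diff I F4"
    using frame unfolding pseudo_null_curve_def by (blast intro: twice_diff_smooth)+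
  have "twice_diff W (\<lambda>u. F (u $ 1))" if "twice_diff I F" for F :: "real \<Rightarrow> real^4"
    by (rule twice_diff_compose_linear[OF bounded_linear_vec_nth that I])
  note F = this[OF sm(1)] this[OF sm(2)] this[OF sm(3)]
  have "twice_diff W \<nu>"
    unfolding \<nu>_def by (intro twice_diff_add twice_diff_scaleR assms F)
  then obtain \<nu>' where \<nu>': "\<And>u. u \<in> W \<Longrightarrow> (\<nu> has_derivative \<nu>' u) (at u)"
    "\<And>u v. u \<in> W \<Longrightarrow> (\<lambda>y. \<nu>' y v) differentiable (at u)"
    by (elim twice_diffE) blast
  interpret tubular_hypersurface \<gamma> F1 F2 k1 c \<eta> W \<nu> \<nu>'
  proof
    fix u assume "u \<in> W"
    note fr = frame[unfolded pseudo_null_curve_def] I[OF this]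
    show "(\<gamma> has_vector_derivative F1 (u $ 1)) (at (u $ 1))"
      and "(F1 has_vector_derivative k1 *\<^sub>R F2 (u $ 1)) (at (u $ 1))"
      and "minkowski (F1 (u $ 1)) (F1 (u $ 1)) = 1"
      using fr by blast+
    show "F2 differentiable (at (u $ 1))"
      using sm(1) I[OF \<open>u \<in> W\<close>] by (elim twice_diffE)
    show "minkowski (\<nu> u) (F1 (u $ 1)) = 0"
      unfolding minkowski_commute[of "\<nu> u"]
      using fr by (simp add: \<nu>_def minkowski.add_right minkowski.scaleR_right)
    have "minkowski (\<nu> u) (\<nu> u) = (B u)\<^sup>2 + 2 * A u * C u"
      using fr minkowski_commute[of "F3 (u $ 1)" "F2 (u $ 1)"]
        minkowski_commute[of "F4 (u $ 1)" "F2 (u $ 1)"]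
        minkowski_commute[of "F4 (u $ 1)" "F3 (u $ 1)"]
      by (simp add: \<nu>_def minkowski.add_right minkowski.scaleR_right minkowski.add_left
          minkowski.scaleR_left power2_eq_square algebra_simps)
    then show "minkowski (\<nu> u) (\<nu> u) = \<eta>"
      by (simp add: norm(2)[OF \<open>u \<in> W\<close>])
  qed (use assms \<nu>' in auto)
  have "tubular_hypersurface.T \<gamma> c \<nu> = T"
    by (simp add: fun_eq_iff T_def assms(10) \<nu>_def)
  then show ?thesis
    using tube_HK_weingarten normal by metis
qed

lemma open_tube_domain:
  assumes "open I" and "open U"
  shows "open (tube_domain I U)"
proof -
  have "continuous_on UNIV (\<lambda>u::real^3. (u $ 1, u $ 2, u $ 3))"
    by (intro continuous_intros)
  from open_vimage[OF open_Times[OF assms] this] show ?thesis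
    by (simp add: tube_domain_def vimage_def)
qed

theorem theorem8:
  fixes \<gamma> F1 F2 F3 F4 :: "real \<Rightarrow> real^4"
    and k1 :: real and k2 k3 :: "real \<Rightarrow> real"
    and f g :: "real \<times> real \<Rightarrow> real"
    and r \<sigma> :: real
    and I :: "real set" and U :: "(real \<times> real) set"
    and T N :: "real^3 \<Rightarrow> real^4"
    and D :: "(real^3) set"
  assumes "pseudo_null_curve I \<gamma> F1 F2 F3 F4 k1 k2 k3"
    and "r > 0" and "\<sigma> \<in> {1, -1}"
    and "open U" and "smooth_on U f" and "smooth_on U g" and "\<forall>p\<in>U. g p \<noteq> 0"
    and "T \<in> {tube1 \<gamma> F2 F3 F4 f g r \<sigma>, tube2 \<gamma> F2 F3 F4 f g r \<sigma>,
               tube3 \<gamma> F2 F3 F4 f g r \<sigma>, tube4 \<gamma> F2 F3 F4 f g r \<sigma>}"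
    and "D = regular_points T (tube_domain I U)"
    and "unit_normal_on D T N"
  shows "HK_weingarten 1 2 D T N \<and> HK_weingarten 1 3 D T N \<and> HK_weingarten 2 3 D T N"
proof -
  let ?W = "tube_domain I U" and ?c = "- (\<sigma> * r)"
  define a where "a u = f (u $ 2, u $ 3)" for u :: "real^3"
  define b where "b u = g (u $ 2, u $ 3)" for u :: "real^3"
  have "open ?W"
    using assms(1,4) by (auto simp: pseudo_null_curve_def intro: open_tube_domain)
  moreover have "?c \<noteq> 0"
    using assms(2,3) by auto
  moreover have "u $ 1 \<in> I" if "u \<in> ?W" for u
    using that by (simp add: tube_domain_def)
  ultimately have general: "HK_weingarten x y D T N"
    if "twice_diff ?W A" "twice_diff ?W B" "twice_diff ?W C" "\<eta> \<in> {1, -1}"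
      "\<And>u. u \<in> ?W \<Longrightarrow> (B u)\<^sup>2 + 2 * A u * C u = \<eta>"
      "\<And>u. T u = \<gamma> (u $ 1) +
        ?c *\<^sub>R (A u *\<^sub>R F2 (u $ 1) + B u *\<^sub>R F3 (u $ 1) + C u *\<^sub>R F4 (u $ 1))"
    for A B C \<eta> x y
    using tube_weingarten[OF assms(1), of ?c ?W A B C \<eta> T N x y] that assms(9,10) by metis
  have "bounded_linear (\<lambda>u::real^3. (u $ 2, u $ 3))"
    by (intro bounded_linear_Pair bounded_linear_vec_nth)
  from twice_diff_compose_linear[OF this twice_diff_smooth, where S = ?W] assms(5,6)
  have a: "twice_diff ?W a" and b: "twice_diff ?W b"
    unfolding a_def b_def by (auto simp: tube_domain_def)
  have b_nz: "b u \<noteq> 0" if "u \<in> ?W" for u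
    using assms(7) that by (simp add: b_def tube_domain_def)
  \<comment> \<open>The four tubes differ only in the pair \<open>(p, q)\<close> of circular or hyperbolic functions of \<open>f\<close> and in the
    sign \<open>e\<close>; the factor \<open>g\<close> cancels in \<open>2 A C = e p\<^sup>2\<close>.\<close>
  have tube: "HK_weingarten x y D T N"
    if "twice_diff ?W p" "twice_diff ?W q" "\<eta> \<in> {1, -1}"
      "\<And>u. (q u)\<^sup>2 + e * (p u)\<^sup>2 = \<eta>"
      "\<And>u. T u = \<gamma> (u $ 1) - (\<sigma> * r) *\<^sub>R ((b u * p u) *\<^sub>R F2 (u $ 1) + q u *\<^sub>R F3 (u $ 1)
        + (e * p u / (2 * b u)) *\<^sub>R F4 (u $ 1))"
    for p q e \<eta> x y
  proof (rule general[where A = "\<lambda>u. b u * p u" and B = q and C = "\<lambda>u. e * p u / (2 * b u)"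
        and \<eta> = \<eta>])
    show "twice_diff ?W (\<lambda>u. b u * p u)"
      by (rule twice_diff_mult[OF b that(1)])
    show "twice_diff ?W (\<lambda>u. e * p u / (2 * b u))"
      by (intro twice_diff_divide twice_diff_mult twice_diff_const that b) (simp add: b_nz)
    show "(q u)\<^sup>2 + 2 * (b u * p u) * (e * p u / (2 * b u)) = \<eta>" if "u \<in> ?W" for u
      using b_nz[OF that] \<open>(q u)\<^sup>2 + e * (p u)\<^sup>2 = \<eta>\<close> by (simp add: power2_eq_square mult_ac)
    show "T u = \<gamma> (u $ 1) + ?c *\<^sub>R ((b u * p u) *\<^sub>R F2 (u $ 1) + q u *\<^sub>R F3 (u $ 1) +
        (e * p u / (2 * b u)) *\<^sub>R F4 (u $ 1))" for u
      by (simp add: that(5))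
  qed (use that in auto)
  consider "T = tube1 \<gamma> F2 F3 F4 f g r \<sigma>" | "T = tube2 \<gamma> F2 F3 F4 f g r \<sigma>"
    | "T = tube3 \<gamma> F2 F3 F4 f g r \<sigma>" | "T = tube4 \<gamma> F2 F3 F4 f g r \<sigma>"
    using assms(8) by blast
  then have "HK_weingarten x y D T N" for x y
  proof cases
    case 1
    show ?thesis
      by (rule tube[OF twice_diff_sin[OF a] twice_diff_cos[OF a], of 1 1])
        (simp_all add: 1 tube1_def Let_def a_def b_def)
  next
    case 2
    show ?thesis
      by (rule tube[OF twice_diff_cos[OF a] twice_diff_sin[OF a], of 1 1])
        (simp_all add: 2 tube2_def Let_def a_def b_def)
  next
    case 3
    show ?thesis
      by (rule tube[OF twice_diff_sinh[OF a] twice_diff_cosh[OF a], of 1 "-1"])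
        (simp_all add: 3 tube3_def Let_def a_def b_def cosh_square_eq)
  next
    case 4
    show ?thesis
      by (rule tube[OF twice_diff_cosh[OF a] twice_diff_sinh[OF a], of "-1" "-1"])
        (simp_all add: 4 tube4_def Let_def a_def b_def cosh_square_eq)
  qed
  then show ?thesis
    by blast
qed

end
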